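(* Let $\rho,\kappa>-1$ be real numbers. The functions $\mathcal{Z}^{\kappa,\rho}_{m,n}$ (with $m\ge0$ and $n$ integers, $n+\rho\ge0$) form an orthogonal system in $L^{2,\kappa}_\rho(\mathbb{D})$ with square norm given by $$\|\mathcal{Z}^{\kappa,\rho}_{m,n}\|^2_{L^{2,\kappa}_\rho(\mathbb{D})}=\frac{\pi\,m!\,(n+\rho)!\,\Gamma(m+\kappa+1)}{(m+n+\rho+\kappa+1)\,\Gamma(n+\rho+\kappa+1)}.$$
   Context: Let $\mathbb{D}=\{z\in\mathbb{C}:|z|<1\}$ and $\mathbb{D}^*=\mathbb{D}\setminus\{0\}$; $\partial/\partial z$ is the Wirtinger derivative. $L^{2,\kappa}_\rho(\mathbb{D})$ is the Hilbert space of complex-valued functions on $\mathbb{D}$ square integrable with respect to $(1-|z|^2)^\kappa|z|^{2\rho}\,dx\,dy$ ($z=x+iy$). For reals $\rho,\kappa>-1$ and integers $m\ge0$, $n$ with $n+\rho\ge0$, the fractional Zernike function on $\mathbb{D}^*$ is $$\mathcal{Z}^{\kappa,\rho}_{m,n}(z,\bar z)=(-1)^m z^{-\rho}(1-|z|^2)^{-\kappa}\frac{\partial^m}{\partial z^m}\Big(z^{n+\rho}(1-|z|^2)^{\kappa+m}\Big),$$ the powers $z^{-\rho}$ and $z^{n+\rho}$ being taken with the same local branch (the result does not depend on the choice). $(n+\rho)!$ means $\Gamma(n+\rho+1)$.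
   Formalization: For non-integer ρ the indices are restricted to m < n+ρ+1, because otherwise the function is not square integrable (e.g. ρ=1/2, κ=0, n=0, m=2) and the printed norm formula fails; for integer ρ all m≥0 and n with n+ρ≥0 are covered. *)

theory Defs
  imports "HOL-Analysis.Analysis"
begin

definition wirtinger :: "(complex \<Rightarrow> complex) \<Rightarrow> complex \<Rightarrow> complex" where
  "wirtinger f z =
     (frechet_derivative f (at z) 1 - \<i> * frechet_derivative f (at z) \<i>) / 2"

text \<open>
  The measure \<open>(1 - |z|\<^sup>2)\<^sup>\<kappa> |z|\<^sup>2\<^sup>\<rho> dx dy\<close> on the open unit disc. The Hilbert space is given by its
  membership predicate, inner product and norm on functions rather than on classes modulo null
  sets, so the value of a function at the origin is irrelevant.
\<close>

definition disc_measure :: "real \<Rightarrow> real \<Rightarrow> complex measure" where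
  "disc_measure \<kappa> \<rho> =
     density (restrict_space lborel (ball 0 1))
       (\<lambda>z. ennreal ((1 - (cmod z)\<^sup>2) powr \<kappa> * cmod z powr (2 * \<rho>)))"

definition in_L2 :: "real \<Rightarrow> real \<Rightarrow> (complex \<Rightarrow> complex) \<Rightarrow> bool" where
  "in_L2 \<kappa> \<rho> f \<longleftrightarrow>
     f \<in> borel_measurable (disc_measure \<kappa> \<rho>) \<and>
     integrable (disc_measure \<kappa> \<rho>) (\<lambda>z. (cmod (f z))\<^sup>2)"

definition L2_inner ::
    "real \<Rightarrow> real \<Rightarrow> (complex \<Rightarrow> complex) \<Rightarrow> (complex \<Rightarrow> complex) \<Rightarrow> complex" where
  "L2_inner \<kappa> \<rho> f g = (\<integral>z. f z * cnj (g z) \<partial>disc_measure \<kappa> \<rho>)"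

definition L2_norm :: "real \<Rightarrow> real \<Rightarrow> (complex \<Rightarrow> complex) \<Rightarrow> real" where
  "L2_norm \<kappa> \<rho> f = sqrt (\<integral>z. (cmod (f z))\<^sup>2 \<partial>disc_measure \<kappa> \<rho>)"

definition orthogonal_system_L2 ::
    "real \<Rightarrow> real \<Rightarrow> ('i \<Rightarrow> complex \<Rightarrow> complex) \<Rightarrow> 'i set \<Rightarrow> bool" where
  "orthogonal_system_L2 \<kappa> \<rho> F I \<longleftrightarrow>
     (\<forall>i\<in>I. in_L2 \<kappa> \<rho> (F i)) \<and>
     (\<forall>i\<in>I. \<forall>j\<in>I. i \<noteq> j \<longrightarrow> L2_inner \<kappa> \<rho> (F i) (F j) = 0)"

text \<open>
  The defining formula at the point \<open>z\<close>, for a branch \<open>L\<close> of the logarithm near \<open>z\<close>; the powers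
  \<open>w\<^sup>s\<close> are \<open>exp (s * L w)\<close>.
\<close>

definition frac_zernike_branch ::
    "(complex \<Rightarrow> complex) \<Rightarrow> real \<Rightarrow> real \<Rightarrow> nat \<Rightarrow> int \<Rightarrow> complex \<Rightarrow> complex" where
  "frac_zernike_branch L \<kappa> \<rho> m n z =
     (- 1) ^ m * exp (- of_real \<rho> * L z) * of_real ((1 - (cmod z)\<^sup>2) powr (- \<kappa>)) *
     (wirtinger ^^ m)
       (\<lambda>w. exp (of_real (of_int n + \<rho>) * L w) *
            of_real ((1 - (cmod w)\<^sup>2) powr (\<kappa> + of_nat m))) z"

text \<open>
  The principal logarithm is discontinuous on the negative real axis, so it is recentred at \<open>z\<close>:
  \<open>w \<mapsto> Ln z + Ln (w / z)\<close> is a holomorphic logarithm near every \<open>z \<noteq> 0\<close>. Any other local branch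
  gives the same value, see \<open>frac_zernike_branch_eq\<close> below.
\<close>

definition frac_zernike :: "real \<Rightarrow> real \<Rightarrow> nat \<Rightarrow> int \<Rightarrow> complex \<Rightarrow> complex" where
  "frac_zernike \<kappa> \<rho> m n z = frac_zernike_branch (\<lambda>w. Ln z + Ln (w / z)) \<kappa> \<rho> m n z"

text \<open>
  The pairs \<open>(m, n)\<close> with \<open>n + \<rho> \<ge> 0\<close> whose function is square integrable. For integer \<open>\<rho>\<close> the
  second conjunct is no restriction. For other \<open>\<rho>\<close> it cannot be dropped: the function then behaves
  like a nonzero multiple of \<open>z\<^sup>n\<^sup>-\<^sup>m\<close> at the origin and is not square integrable unless
  \<open>m < n + \<rho> + 1\<close>, see \<open>not_in_L2_frac_zernike\<close> below.
\<close>

definition zernike_indices :: "real \<Rightarrow> (nat \<times> int) set" where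
  "zernike_indices \<rho> =
     {(m, n). 0 \<le> of_int n + \<rho> \<and> (\<rho> \<in> \<int> \<or> of_nat m < of_int n + \<rho> + 1)}"


subsection \<open>Independence of the branch\<close>

lemma wirtinger_eqI:
  assumes "(f has_derivative D) (at z)"
  shows "wirtinger f z = (D 1 - \<i> * D \<i>) / 2"
  using frechet_derivative_at[OF assms] by (simp add: wirtinger_def)

lemma wirtinger_cong_open:
  assumes "open U" "z \<in> U" "\<And>w. w \<in> U \<Longrightarrow> f w = g w"
  shows "wirtinger f z = wirtinger g z"
proof -
  have "(f has_derivative D) (at z) = (g has_derivative D) (at z)" for D
    using has_derivative_transform_within_open[OF _ assms(1,2), of f D UNIV g]
      has_derivative_transform_within_open[OF _ assms(1,2), of g D UNIV f] assms(3)
    by auto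
  then show ?thesis by (simp add: wirtinger_def frechet_derivative_def)
qed

lemma wirtinger_step:
  fixes h :: "real \<Rightarrow> real"
  assumes U: "open U" "w \<in> U" and L: "L holomorphic_on U" "\<And>w. w \<in> U \<Longrightarrow> exp (L w) = w"
    and h: "(h has_real_derivative h') (at ((cmod w)\<^sup>2))"
  shows "wirtinger (\<lambda>w. exp (of_real c * L w) * of_real (h ((cmod w)\<^sup>2))) w =
    exp (of_real (c - 1) * L w) * of_real (c * h ((cmod w)\<^sup>2) + (cmod w)\<^sup>2 * h')"
proof -
  have w: "exp (L w) = w" using L U by auto
  then have w0: "w \<noteq> 0" using exp_not_eq_zero[of "L w"] by auto
  have dL: "(L has_field_derivative deriv L w) (at w)"
    using holomorphic_derivI[OF L(1) U] .
  have "((\<lambda>w. exp (L w)) has_field_derivative exp (L w) * deriv L w) (at w)"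
    using dL by (auto intro!: derivative_eq_intros)
  moreover have "((\<lambda>w. exp (L w)) has_field_derivative 1) (at w)"
    by (rule has_field_derivative_transform_within_open[OF DERIV_ident U]) (simp add: L)
  ultimately have "exp (L w) * deriv L w = 1" by (rule DERIV_unique)
  then have dLw: "deriv L w = 1 / w" using w w0 by (simp add: field_simps)
  have d1: "((\<lambda>w. exp (of_real c * L w)) has_derivative
      (\<lambda>v. (of_real c * (1 / w) * exp (of_real c * L w)) * v)) (at w)"
    using dL unfolding dLw
    by (intro has_field_derivative_imp_has_derivative) (auto intro!: derivative_eq_intros)
  have d2: "((\<lambda>w. (cmod w)\<^sup>2) has_derivative (\<lambda>v. 2 * inner w v)) (at w)"
    unfolding power2_norm_eq_inner
    by (auto intro!: derivative_eq_intros simp: inner_commute)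
  have d3: "((\<lambda>w. h ((cmod w)\<^sup>2)) has_derivative (\<lambda>v. (2 * inner w v) * h')) (at w)"
    using has_derivative_compose[OF d2 h[unfolded has_field_derivative_def]]
    by (simp add: mult.commute)
  have d4: "((\<lambda>w. of_real (h ((cmod w)\<^sup>2)) :: complex) has_derivative
       (\<lambda>v. of_real ((2 * inner w v) * h'))) (at w)"
    using d3 by (rule has_derivative_of_real)
  have e: "exp (of_real c * L w) = exp (of_real (c - 1) * L w) * w"
    using w w0 by (simp add: algebra_simps exp_diff)
  have cnj: "cnj w = of_real (Re w) - \<i> * of_real (Im w)"
    by (simp add: complex_eq_iff)
  have "wirtinger (\<lambda>w. exp (of_real c * L w) * of_real (h ((cmod w)\<^sup>2))) w =
     exp (of_real c * L w) * (of_real h' * cnj w + of_real c / w * of_real (h ((cmod w)\<^sup>2)))"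
    by (subst wirtinger_eqI[OF has_derivative_mult[OF d1 d4]])
       (simp add: cnj field_simps)
  also have "\<dots> = exp (of_real (c - 1) * L w) *
      (of_real c * of_real (h ((cmod w)\<^sup>2)) + (w * cnj w) * of_real h')"
    unfolding e using w0 by (simp add: field_simps)
  also have "w * cnj w = of_real ((cmod w)\<^sup>2)"
    using complex_norm_square[of w] by simp
  finally show ?thesis by simp
qed

fun radial_poly :: "real \<Rightarrow> real \<Rightarrow> nat \<Rightarrow> real poly" where
  "radial_poly a b 0 = 1"
| "radial_poly a b (Suc m) =
     smult (a - of_nat m) ([:1, -1:] * radial_poly a b m) +
     pCons 0 ([:1, -1:] * pderiv (radial_poly a b m) - smult (b - of_nat m) (radial_poly a b m))"

lemma poly_radial_poly_0: "poly (radial_poly a b m) 0 = (\<Prod>i<m. a - of_nat i)"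
  by (induction m) (auto simp: mult.commute)

lemma wirtinger_funpow:
  assumes U: "open U" "U \<subseteq> ball 0 1" and L: "L holomorphic_on U" "\<And>w. w \<in> U \<Longrightarrow> exp (L w) = w"
    and "w \<in> U"
  shows "(wirtinger ^^ m) (\<lambda>w. exp (of_real a * L w) * of_real ((1 - (cmod w)\<^sup>2) powr b)) w =
    exp (of_real (a - of_nat m) * L w) *
    of_real ((1 - (cmod w)\<^sup>2) powr (b - of_nat m) * poly (radial_poly a b m) ((cmod w)\<^sup>2))"
  using \<open>w \<in> U\<close>
proof (induction m arbitrary: w)
  case 0
  then show ?case by simp
next
  case (Suc m)
  let ?P = "radial_poly a b m"
  let ?h = "\<lambda>t. (1 - t) powr (b - of_nat m) * poly ?P t"
  let ?t = "(cmod w)\<^sup>2"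
  have "cmod w < 1" using Suc.prems U by auto
  then have t: "?t < 1" by (simp add: power_less_one_iff abs_square_less_1)
  have dh: "(?h has_real_derivative
      (1 - ?t) powr (b - of_nat (Suc m)) * ((1 - ?t) * poly (pderiv ?P) ?t - (b - of_nat m) * poly ?P ?t))
      (at ?t)"
  proof -
    have p: "(1 - ?t) powr (b - real m) = (1 - ?t) powr (b - real (Suc m)) * (1 - ?t)"
      using t powr_add[of "1 - ?t" "b - real (Suc m)" 1] by simp
    have "((\<lambda>t. (1 - t) powr (b - real m)) has_real_derivative
        (b - real m) * (1 - ?t) powr (b - real m - 1) * (- 1)) (at ?t)"
    proof -
      have "((\<lambda>x. x powr (b - real m)) has_real_derivative
          (b - real m) * (1 - ?t) powr (b - real m - 1)) (at (1 - ?t))"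
        using t by (intro has_real_derivative_powr) auto
      moreover have "((\<lambda>t. 1 - t) has_real_derivative - 1) (at ?t)"
        by (auto intro!: derivative_eq_intros)
      ultimately show ?thesis by (rule DERIV_chain2)
    qed
    from DERIV_mult[OF this poly_DERIV[of ?P ?t]] show ?thesis
      by (rule DERIV_cong) (simp add: p algebra_simps)
  qed
  have "(wirtinger ^^ Suc m) (\<lambda>w. exp (of_real a * L w) * of_real ((1 - (cmod w)\<^sup>2) powr b)) w =
    wirtinger (\<lambda>w. exp (of_real (a - of_nat m) * L w) * of_real (?h ((cmod w)\<^sup>2))) w"
    by (simp only: funpow.simps comp_def)
       (rule wirtinger_cong_open[OF U(1) Suc.prems Suc.IH])
  also have "\<dots> = exp (of_real (a - of_nat m - 1) * L w) * of_real ((a - of_nat m) * ?h ?t + ?t *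
     ((1 - ?t) powr (b - of_nat (Suc m)) * ((1 - ?t) * poly (pderiv ?P) ?t - (b - of_nat m) * poly ?P ?t)))"
    by (rule wirtinger_step[OF U(1) Suc.prems L dh])
  also have "(a - of_nat m) * ?h ?t + ?t *
     ((1 - ?t) powr (b - of_nat (Suc m)) * ((1 - ?t) * poly (pderiv ?P) ?t - (b - of_nat m) * poly ?P ?t))
     = (1 - ?t) powr (b - of_nat (Suc m)) * poly (radial_poly a b (Suc m)) ?t"
  proof -
    have p: "(1 - ?t) powr (b - real m) = (1 - ?t) powr (b - real (Suc m)) * (1 - ?t)"
      using t powr_add[of "1 - ?t" "b - real (Suc m)" 1] by simp
    show ?thesis unfolding p by (simp add: algebra_simps)
  qed
  finally show ?case by (simp add: algebra_simps)
qed

lemma frac_zernike_branch_explicit: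
  assumes U: "open U" "z \<in> U" "U \<subseteq> ball 0 1"
    and L: "L holomorphic_on U" "\<And>w. w \<in> U \<Longrightarrow> exp (L w) = w"
  shows "frac_zernike_branch L \<kappa> \<rho> m n z =
    (- 1) ^ m * z powi (n - int m) *
    of_real (poly (radial_poly (of_int n + \<rho>) (\<kappa> + of_nat m) m) ((cmod z)\<^sup>2))"
    (is "_ = _ * of_real ?p")
proof -
  have "cmod z < 1" using U by auto
  then have t: "(cmod z)\<^sup>2 < 1" by (simp add: power_less_one_iff abs_square_less_1)
  have e: "exp (- of_real \<rho> * L z) * exp (of_real (of_int n + \<rho> - of_nat m) * L z) =
      z powi (n - int m)"
  proof -
    have "exp (- of_real \<rho> * L z) * exp (of_real (of_int n + \<rho> - of_nat m) * L z) =
       exp (of_int (n - int m) * L z)"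
      by (subst exp_add[symmetric]) (simp add: algebra_simps)
    also have "\<dots> = exp (L z) powi (n - int m)"
      by (simp add: exp_power_int)
    finally show ?thesis using L U by simp
  qed
  have p: "(1 - (cmod z)\<^sup>2) powr (- \<kappa>) * (1 - (cmod z)\<^sup>2) powr \<kappa> = 1"
    using t by (simp add: powr_add[symmetric])
  then have p': "of_real ((1 - (cmod z)\<^sup>2) powr (- \<kappa>)) * of_real ((1 - (cmod z)\<^sup>2) powr \<kappa>) =
      (1 :: complex)" by (metis of_real_mult of_real_1)
  show ?thesis
    unfolding frac_zernike_branch_def
  proof (subst wirtinger_funpow[OF U(1,3) L U(2)], assumption)
    show "(- 1) ^ m * exp (- of_real \<rho> * L z) * of_real ((1 - (cmod z)\<^sup>2) powr (- \<kappa>)) *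
      (exp (of_real (of_int n + \<rho> - of_nat m) * L z) *
       of_real ((1 - (cmod z)\<^sup>2) powr (\<kappa> + of_nat m - of_nat m) * ?p)) =
      (- 1) ^ m * z powi (n - int m) * of_real ?p"
      (is "?s * ?A * ?B * (?C * _) = _")
    proof -
      have "?s * ?A * ?B * (?C * of_real ((1 - (cmod z)\<^sup>2) powr (\<kappa> + of_nat m - of_nat m) * ?p)) =
        ?s * (?A * ?C) * (?B * of_real ((1 - (cmod z)\<^sup>2) powr \<kappa>)) * of_real ?p"
        by (simp only: of_real_mult add_diff_cancel_right' mult_ac)
      then show ?thesis by (simp only: e p' mult_1_right)
    qed
  qed
qed

lemma frac_zernike_explicit:
  assumes z: "z \<noteq> 0" "cmod z < 1"
  shows "frac_zernike \<kappa> \<rho> m n z =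
    (- 1) ^ m * z powi (n - int m) *
    of_real (poly (radial_poly (of_int n + \<rho>) (\<kappa> + of_nat m) m) ((cmod z)\<^sup>2))"
proof -
  let ?U = "ball z (cmod z) \<inter> ball 0 1"
  have Re: "Re (w / z) > 0" if "w \<in> ?U" for w
  proof -
    have "cmod (w / z - 1) = cmod (w - z) / cmod z"
      using z by (simp add: norm_divide[symmetric] diff_divide_distrib)
    also have "\<dots> < 1" using that z by (simp add: dist_norm norm_minus_commute)
    finally have "\<bar>Re (w / z - 1)\<bar> < 1" using abs_Re_le_cmod le_less_trans by blast
    then show ?thesis by simp
  qed
  have "(\<lambda>w. Ln z + Ln (w / z)) holomorphic_on ?U"
    using z Re by (intro holomorphic_intros) (auto simp: complex_nonpos_Reals_iff dest: leD)
  moreover have "exp (Ln z + Ln (w / z)) = w" if "w \<in> ?U" for w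
  proof -
    have "w / z \<noteq> 0" using Re[OF that] by auto
    then show ?thesis using z(1) by (simp add: exp_add exp_Ln)
  qed
  ultimately show ?thesis
    unfolding frac_zernike_def
    using z by (intro frac_zernike_branch_explicit[of ?U]) auto
qed

lemma frac_zernike_branch_eq:
  assumes U: "open U" "z \<in> U" "z \<in> ball 0 1"
    and L: "L holomorphic_on U" "\<And>w. w \<in> U \<Longrightarrow> exp (L w) = w"
  shows "frac_zernike_branch L \<kappa> \<rho> m n z = frac_zernike \<kappa> \<rho> m n z"
proof -
  have "z \<noteq> 0" using L(2)[OF U(2)] exp_not_eq_zero[of "L z"] by auto
  moreover have "L holomorphic_on (U \<inter> ball 0 1)" using L by (auto intro: holomorphic_on_subset)
  ultimately show ?thesis
    using U L
    by (subst frac_zernike_branch_explicit[of "U \<inter> ball 0 1"]) (auto simp: frac_zernike_explicit)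
qed


subsection \<open>Failure of square integrability outside \<^const>\<open>zernike_indices\<close>\<close>

lemma not_integrable_inverse_square:
  fixes g :: "complex \<Rightarrow> real"
  assumes "0 < c" "0 < \<delta>" and g: "\<And>z. z \<noteq> 0 \<Longrightarrow> cmod z < \<delta> \<Longrightarrow> c / (cmod z)\<^sup>2 \<le> g z"
  shows "\<not> integrable lborel g"
proof
  assume int: "integrable lborel g"
  define B where "B k = ball (0::complex) (\<delta> / 2 ^ k) - {0}" for k :: nat
  define \<nu> where "\<nu> = density lborel (\<lambda>z. ennreal \<bar>g z\<bar>)"
  have [measurable]: "g \<in> borel_measurable borel" using int by auto
  have Bs: "B k \<in> sets borel" for k unfolding B_def by auto
  have em: "emeasure \<nu> A = (\<integral>\<^sup>+z. ennreal \<bar>g z\<bar> * indicator A z \<partial>lborel)" if "A \<in> sets borel" for A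
    unfolding \<nu>_def using that by (subst emeasure_density) auto
  have fin: "emeasure \<nu> (B k) \<noteq> \<infinity>" for k
  proof -
    have "emeasure \<nu> (B k) \<le> (\<integral>\<^sup>+z. ennreal \<bar>g z\<bar> \<partial>lborel)"
      unfolding em[OF Bs] by (intro nn_integral_mono) (auto simp: indicator_def)
    also have "\<dots> < \<infinity>" using int by (auto simp: integrable_iff_bounded)
    finally show ?thesis by auto
  qed
  have dec: "decseq B"
  proof (rule decseq_SucI)
    fix k
    have "\<delta> / 2 ^ Suc k \<le> \<delta> / 2 ^ k" using \<open>0 < \<delta>\<close> by (simp add: field_simps)
    then show "B (Suc k) \<subseteq> B k" unfolding B_def by (auto intro: less_le_trans)
  qed
  have "(\<Inter>k. B k) = {}"
  proof -
    have "\<exists>k. z \<notin> B k" for z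
    proof (cases "z = 0")
      case False
      obtain k where "\<delta> / cmod z < 2 ^ k" using real_arch_pow[of 2] by auto
      then have "\<delta> / 2 ^ k < cmod z" using False by (simp add: field_simps)
      then show ?thesis unfolding B_def by (intro exI[of _ k]) auto
    qed (auto simp: B_def)
    then show ?thesis by auto
  qed
  then have lim: "(\<lambda>k. emeasure \<nu> (B k)) \<longlonglongrightarrow> 0"
    using Lim_emeasure_decseq[of B \<nu>] dec fin Bs by (auto simp: \<nu>_def image_subset_iff)
  have "ennreal (c * pi) \<le> emeasure \<nu> (B k)" for k
  proof -
    let ?r = "\<delta> / 2 ^ k"
    have r: "0 < ?r" using \<open>0 < \<delta>\<close> by simp
    have rd: "?r \<le> \<delta>" using \<open>0 < \<delta>\<close> by (simp add: field_simps)
    have "emeasure lborel (B k) = emeasure lborel (ball (0::complex) ?r)"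
      unfolding B_def by (rule emeasure_Diff_null_set) auto
    also have "\<dots> = ennreal (pi * ?r\<^sup>2)"
      using r by (subst emeasure_ball) (auto simp: unit_ball_vol_2)
    finally have mB: "emeasure lborel (B k) = ennreal (pi * ?r\<^sup>2)" .
    have "ennreal (c * pi) = ennreal (c / ?r\<^sup>2) * emeasure lborel (B k)"
      unfolding mB using r \<open>0 < c\<close> by (subst ennreal_mult[symmetric]) (auto simp: field_simps)
    also have "\<dots> = (\<integral>\<^sup>+z. ennreal (c / ?r\<^sup>2) * indicator (B k) z \<partial>lborel)"
      using Bs by (subst nn_integral_cmult_indicator) auto
    also have "\<dots> \<le> (\<integral>\<^sup>+z. ennreal \<bar>g z\<bar> * indicator (B k) z \<partial>lborel)"
    proof (intro nn_integral_mono)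
      fix z :: complex
      show "ennreal (c / ?r\<^sup>2) * indicator (B k) z \<le> ennreal \<bar>g z\<bar> * indicator (B k) z"
      proof (cases "z \<in> B k")
        case True
        then have z: "z \<noteq> 0" "cmod z < ?r" unfolding B_def by auto
        have "c / ?r\<^sup>2 \<le> c / (cmod z)\<^sup>2"
          using z r \<open>0 < c\<close> by (intro divide_left_mono power_mono mult_pos_pos) auto
        also have "\<dots> \<le> \<bar>g z\<bar>" using g[of z] z rd by linarith
        finally show ?thesis using True by (simp add: ennreal_leI)
      qed simp
    qed
    also have "\<dots> = emeasure \<nu> (B k)" by (simp add: em Bs)
    finally show ?thesis .
  qed
  then have "ennreal (c * pi) \<le> 0"
    by (intro LIMSEQ_le_const[OF lim]) auto
  then show False using mult_pos_pos[OF \<open>0 < c\<close> pi_gt_zero] by (simp add: ennreal_eq_0_iff)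
qed

lemma not_in_L2_frac_zernike:
  assumes n: "0 \<le> of_int n + \<rho>" and mn: "(m, n) \<notin> zernike_indices \<rho>"
  shows "\<not> in_L2 \<kappa> \<rho> (frac_zernike \<kappa> \<rho> m n)"
proof
  assume "in_L2 \<kappa> \<rho> (frac_zernike \<kappa> \<rho> m n)"
  define W where "W z = (1 - (cmod z)\<^sup>2) powr \<kappa> * cmod z powr (2 * \<rho>)" for z :: complex
  define f where "f z = (cmod (frac_zernike \<kappa> \<rho> m n z))\<^sup>2" for z
  define P where "P = radial_poly (of_int n + \<rho>) (\<kappa> + of_nat m) m"
  have \<rho>: "\<rho> \<notin> \<int>" and m: "of_int n + \<rho> + 1 \<le> of_nat m"
    using n mn unfolding zernike_indices_def by auto
  have W [measurable]: "W \<in> borel_measurable (restrict_space lborel (ball 0 1))"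
    unfolding W_def by (intro measurable_restrict_space1) auto
  have "integrable (disc_measure \<kappa> \<rho>) f" "(\<lambda>z. frac_zernike \<kappa> \<rho> m n z) \<in> borel_measurable (disc_measure \<kappa> \<rho>)"
    using \<open>in_L2 _ _ _\<close> unfolding in_L2_def f_def by auto
  moreover from this(2) have "f \<in> borel_measurable (restrict_space lborel (ball 0 1))"
    unfolding disc_measure_def f_def by simp
  ultimately have "integrable (restrict_space lborel (ball 0 1)) (\<lambda>z. W z * f z)"
    unfolding disc_measure_def W_def[symmetric]
    by (subst (asm) integrable_density) (auto simp: W_def)
  then have int: "integrable lborel (\<lambda>z. indicator (ball 0 1) z * (W z * f z))"
    by (subst (asm) integrable_restrict_space) auto
  have "poly P 0 \<noteq> 0"
  proof -
    have "of_int n + \<rho> - of_nat i \<noteq> 0" for i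
    proof
      assume "of_int n + \<rho> - of_nat i = 0"
      then have "\<rho> = of_int (int i - n)" by simp
      then show False using \<rho> by (metis Ints_of_int)
    qed
    then show ?thesis by (simp add: P_def poly_radial_poly_0)
  qed
  define c where "c = \<bar>poly P 0\<bar> / 2"
  have c: "0 < c" using \<open>poly P 0 \<noteq> 0\<close> by (simp add: c_def)
  have "isCont (\<lambda>z. (1 - (cmod z)\<^sup>2) powr \<kappa>) 0" "isCont (\<lambda>z. \<bar>poly P ((cmod z)\<^sup>2)\<bar>) 0"
    by (auto intro!: continuous_intros)
  then have "\<forall>\<^sub>F z in at 0. (1 - (cmod z)\<^sup>2) powr \<kappa> > 1 / 2" "\<forall>\<^sub>F z in at 0. \<bar>poly P ((cmod z)\<^sup>2)\<bar> > c"
    unfolding isCont_def using c by (auto elim!: order_tendstoD(1) simp: c_def simp del: less_divide_eq_numeral1 divide_less_eq_numeral1)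
  then have "\<forall>\<^sub>F z in at 0. (1 - (cmod z)\<^sup>2) powr \<kappa> > 1 / 2 \<and> \<bar>poly P ((cmod z)\<^sup>2)\<bar> > c"
    by (rule eventually_conj)
  then obtain d where d: "0 < d"
     "\<And>z. z \<noteq> 0 \<Longrightarrow> cmod z < d \<Longrightarrow> (1 - (cmod z)\<^sup>2) powr \<kappa> > 1 / 2 \<and> \<bar>poly P ((cmod z)\<^sup>2)\<bar> > c"
    unfolding eventually_at by (auto simp: dist_norm)
  have "(c\<^sup>2 / 2) / (cmod z)\<^sup>2 \<le> indicator (ball 0 1) z * (W z * f z)"
    if z: "z \<noteq> 0" "cmod z < min d 1" for z
  proof -
    have r: "0 < cmod z" "cmod z < 1" using z by auto
    have "f z = (cmod z powi (n - int m) * \<bar>poly P ((cmod z)\<^sup>2)\<bar>)\<^sup>2"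
      using z by (simp add: f_def frac_zernike_explicit P_def norm_mult norm_power norm_power_int)
    also have "cmod z powi (n - int m) = cmod z powr (of_int n - of_nat m)"
      using r by (subst powr_real_of_int'[symmetric]) auto
    finally have f: "f z = cmod z powr (2 * (of_int n - of_nat m)) * \<bar>poly P ((cmod z)\<^sup>2)\<bar>\<^sup>2"
      by (simp only: power_mult_distrib mult_2 powr_add power2_eq_square[of "_ powr _"])
    have wf: "W z * f z = cmod z powr (2 * (of_int n - of_nat m + \<rho>)) *
       ((1 - (cmod z)\<^sup>2) powr \<kappa> * \<bar>poly P ((cmod z)\<^sup>2)\<bar>\<^sup>2)"
    proof -
      have "cmod z powr (2 * (of_int n - of_nat m + \<rho>)) =
          cmod z powr (2 * \<rho>) * cmod z powr (2 * (of_int n - of_nat m))"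
        by (simp add: powr_add[symmetric] algebra_simps)
      then show ?thesis unfolding W_def f by (simp only: mult_ac)
    qed
    have "c\<^sup>2 / 2 = 1 / 2 * c\<^sup>2" by simp
    also have "\<dots> \<le> (1 - (cmod z)\<^sup>2) powr \<kappa> * \<bar>poly P ((cmod z)\<^sup>2)\<bar>\<^sup>2"
      using d(2)[of z] z c by (intro mult_mono power_mono) auto
    finally have 1: "c\<^sup>2 / 2 \<le> (1 - (cmod z)\<^sup>2) powr \<kappa> * \<bar>poly P ((cmod z)\<^sup>2)\<bar>\<^sup>2" .
    have "1 / (cmod z)\<^sup>2 = cmod z powr (- 2)"
      using r by (simp add: powr_minus divide_inverse powr_numeral)
    also have "\<dots> \<le> cmod z powr (2 * (of_int n - of_nat m + \<rho>))"
      using r m by (intro powr_mono') auto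
    finally have 2: "1 / (cmod z)\<^sup>2 \<le> cmod z powr (2 * (of_int n - of_nat m + \<rho>))" .
    have "1 / (cmod z)\<^sup>2 * (c\<^sup>2 / 2) \<le> W z * f z"
      unfolding wf using 1 2 by (intro mult_mono) auto
    then show ?thesis using r by simp
  qed
  then have "\<not> integrable lborel (\<lambda>z. indicator (ball 0 1) z * (W z * f z))"
    using c d(1) by (intro not_integrable_inverse_square[of "c\<^sup>2 / 2" "min d 1"]) auto
  with int show False by simp
qed

end

theory Submission
  imports Defs
begin

text \<open>
  Off the origin the function with indices \<open>m\<close>, \<open>n\<close> is \<open>\<plusminus> z\<^bsup>n-m\<^esup>
  R(|z|\<^sup>2)\<close> with \<open>R = radial_poly a (\<kappa> + m) m\<close> and \<open>a = n + \<rho>\<close>. Rotating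
  the disc multiplies the product of one such function with the conjugate of another by a character of the circle. This
  character is nontrivial unless both have the same frequency \<open>n - m\<close>, so different frequencies are orthogonal
  (\<open>zernike_angular_orthogonal\<close>).

  For equal frequencies the substitution \<open>t = |z|\<^sup>2\<close> turns the inner product into
  \<open>\<plusminus>\<pi>\<close> times the Jacobi integral of \<open>t\<^sup>s (1-t)\<^sup>\<kappa> R(t) R'(t)\<close> over
  \<open>[0, 1]\<close>, with the common exponent \<open>s = n - m + \<rho>\<close>, where \<open>R'\<close> is the
  polynomial of the other pair \<open>(m', n')\<close>. By symmetry one may take \<open>m' \<le> m\<close>. The Wirtinger
  derivative acts on the radial part as a derivative in \<open>t\<close>, so \<open>R\<close> obeys the Rodrigues formula
  \<open>t\<^bsup>a-m\<^esup> (1-t)\<^sup>\<kappa> R = (d/dt)\<^sup>m (t\<^sup>a (1-t)\<^bsup>\<kappa>+m\<^esup>)\<close>.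
  Integrating by parts \<open>m\<close> times moves the derivatives to \<open>R'\<close>
  (\<open>jacobi_moment_radial_poly\<close>). Since \<open>R'\<close> has degree at most \<open>m'\<close>, the result is
  zero for \<open>m' < m\<close>; for \<open>m' = m\<close> it is, up to sign, \<open>m!\<close> times the leading
  coefficient of \<open>R\<close> times a Beta value, which is the norm formula.

  It may happen that \<open>s \<le> -1\<close>; by the choice of the index set this occurs only for integer
  \<open>\<rho>\<close>. The low coefficients of \<open>R\<close> and \<open>R'\<close> then vanish. All that the
  integrations by parts need at the endpoint \<open>0\<close> is that \<open>t\<^bsup>s+i\<^esup>\<close> is integrable for
  every monomial \<open>t\<^sup>i\<close> of \<open>R'\<close>, and this condition (\<open>integrable_at_0\<close>) survives
  each step: the exponent rises by one while the degrees of the monomials drop by one. No boundary terms have to be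
  discussed, because one step is, on monomials, the recurrence \<open>x B(x, y+1) = y B(x+1, y)\<close>.
\<close>


section \<open>Coefficients of the radial polynomials\<close>

lemma coeff_radial_poly_Suc:
  "coeff (radial_poly a b (Suc m)) i =
     (a - of_nat m + of_nat i) * coeff (radial_poly a b m) i -
     (if i = 0 then 0 else (a + b - 2 * of_nat m + of_nat i - 1) * coeff (radial_poly a b m) (i - 1))"
  by (cases i; cases "i - 1")
    (simp_all add: coeff_pCons coeff_pderiv algebra_simps split: nat.splits)

lemma coeff_radial_poly_eq_0: "m < i \<Longrightarrow> coeff (radial_poly a b m) i = 0"
proof (induction m arbitrary: i)
  case 0
  then show ?case by simp
next
  case (Suc m)
  then show ?case by (simp del: radial_poly.simps add: coeff_radial_poly_Suc)
qed

lemma degree_radial_poly_le: "degree (radial_poly a b m) \<le> m"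
  by (intro degree_le) (simp add: coeff_radial_poly_eq_0)

lemma coeff_radial_poly_top:
  "coeff (radial_poly a b m) m = (- 1) ^ m * pochhammer (a + b - of_nat m + 1) m"
proof (induction m)
  case (Suc m)
  have "coeff (radial_poly a b (Suc m)) (Suc m) = - ((a + b - of_nat m) * coeff (radial_poly a b m) m)"
    by (simp add: coeff_radial_poly_Suc coeff_radial_poly_eq_0 del: radial_poly.simps)
  also have "\<dots> = (- 1) ^ Suc m * ((a + b - of_nat m) * pochhammer (a + b - of_nat m + 1) m)"
    by (simp add: Suc.IH)
  also have "(a + b - of_nat m) * pochhammer (a + b - of_nat m + 1) m =
      pochhammer (a + b - of_nat (Suc m) + 1) (Suc m)"
    by (simp add: pochhammer_rec algebra_simps)
  finally show ?case .
qed simp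

text \<open>
  The \<open>m\<close>-th derivative of \<open>t\<^sup>N (1-t)\<^sup>b\<close> is regular at \<open>0\<close>, so the polynomial has to cancel the pole
  of \<open>t\<^bsup>N-m\<^esup>\<close>. In the recurrence the factor \<open>N - m + i\<close> kills the one coefficient that the induction
  hypothesis does not reach.
\<close>

lemma coeff_radial_poly_low:
  "i + N < m \<Longrightarrow> coeff (radial_poly (of_nat N) b m) i = 0"
proof (induction m arbitrary: i)
  case (Suc m)
  show ?case
  proof (cases "i + N < m")
    case True
    then show ?thesis
      by (simp add: coeff_radial_poly_Suc Suc.IH del: radial_poly.simps)
  next
    case False
    then have "m = i + N" using Suc.prems by simp
    then show ?thesis
      using Suc.IH[of "i - 1"] by (cases i) (simp_all add: coeff_radial_poly_Suc del: radial_poly.simps)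
  qed
qed simp

section \<open>Jacobi moments and integration by parts\<close>

text \<open>
  Integrability of \<open>t\<^sup>s p(t)\<close> at \<open>0\<close>, phrased through the coefficients so that it also covers
  \<open>s \<le> -1\<close> when \<open>p\<close> vanishes at \<open>0\<close> to sufficient order.
\<close>

definition integrable_at_0 :: "real \<Rightarrow> real poly \<Rightarrow> bool" where
  "integrable_at_0 s p \<longleftrightarrow> (\<forall>i. coeff p i \<noteq> 0 \<longrightarrow> s + of_nat i > -1)"

definition jacobi_moment :: "real \<Rightarrow> real \<Rightarrow> real poly \<Rightarrow> real" where
  "jacobi_moment s c p = (LINT t:{0..1}|lborel. t powr s * (1 - t) powr c * poly p t)"

lemma integrable_at_0_mult:
  assumes "integrable_at_0 s q"
  shows "integrable_at_0 s (p * q)"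
  unfolding integrable_at_0_def
proof (intro allI impI)
  fix i assume "coeff (p * q) i \<noteq> 0"
  then obtain j where "j \<le> i" "coeff q (i - j) \<noteq> 0"
    unfolding coeff_mult by (metis (no_types, lifting) atMost_iff mult_zero_right sum.neutral)
  with assms have "s + of_nat (i - j) > - 1" unfolding integrable_at_0_def by blast
  then show "s + of_nat i > -1" by linarith
qed

lemma integrable_at_0_pderiv: "integrable_at_0 s q \<Longrightarrow> integrable_at_0 (s + 1) (pderiv q)"
  unfolding integrable_at_0_def by (fastforce simp: coeff_pderiv add_ac)

lemma integrable_at_0_pCons_0: "integrable_at_0 (s + 1) p \<Longrightarrow> integrable_at_0 s (pCons 0 p)"
  unfolding integrable_at_0_def by (fastforce simp: coeff_pCons add_ac split: nat.splits)

lemma has_bochner_integral_powr_Beta: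
  fixes s c :: real
  assumes "s > -1" "c > -1"
  shows "has_bochner_integral lborel
    (\<lambda>t. indicator {0..1} t *\<^sub>R (t powr s * (1 - t) powr c)) (Beta (s + 1) (c + 1))"
proof -
  have 1: "set_integrable lborel {0..1} (\<lambda>t. t powr s * (1 - t) powr c)"
    using integrable_Beta[of "s + 1" "c + 1"] assms by simp
  have "(LINT t:{0..1}|lborel. t powr s * (1 - t) powr c) = Beta (s + 1) (c + 1)"
    using set_borel_integral_eq_integral(2)[OF 1] has_integral_Beta_real[of "s + 1" "c + 1"] assms
    by (simp add: integral_unique)
  with 1 show ?thesis
    by (simp add: has_bochner_integral_iff set_integrable_def set_lebesgue_integral_def)
qed

lemma powr_mult_poly_eq_sum:
  fixes t :: real
  assumes "0 \<le> t"
  shows "t powr s * (1 - t) powr c * poly p t =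
    (\<Sum>i\<le>degree p. coeff p i * (t powr (s + of_nat i) * (1 - t) powr c))"
proof -
  (* at t = 0 both sides vanish because 0 powr x = 0, also for x = 0 *)
  have "t powr (s + real i) = t powr s * t ^ i" for i
    using assms by (cases "t = 0") (auto simp: powr_add powr_realpow)
  then show ?thesis by (simp add: poly_altdef sum_distrib_left mult_ac)
qed

lemma has_bochner_integral_jacobi:
  assumes "integrable_at_0 s p" "c > -1"
  shows "has_bochner_integral lborel (\<lambda>t. indicator {0..1} t *\<^sub>R (t powr s * (1 - t) powr c * poly p t))
    (\<Sum>i\<le>degree p. coeff p i * Beta (s + of_nat i + 1) (c + 1))"
proof -
  have "has_bochner_integral lborel
      (\<lambda>t. coeff p i *\<^sub>R (indicator {0..1} t *\<^sub>R (t powr (s + of_nat i) * (1 - t) powr c)))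
      (coeff p i *\<^sub>R Beta (s + of_nat i + 1) (c + 1))" for i
    using assms has_bochner_integral_powr_Beta[of "s + of_nat i" c]
    by (cases "coeff p i = 0")
      (auto simp: integrable_at_0_def simp del: scaleR_conv_of_real intro!: has_bochner_integral_scaleR_right)
  then have "has_bochner_integral lborel
      (\<lambda>t. \<Sum>i\<le>degree p. coeff p i *\<^sub>R (indicator {0..1} t *\<^sub>R (t powr (s + of_nat i) * (1 - t) powr c)))
      (\<Sum>i\<le>degree p. coeff p i *\<^sub>R Beta (s + of_nat i + 1) (c + 1))"
    by (intro has_bochner_integral_sum)
  moreover have "(\<Sum>i\<le>degree p. coeff p i *\<^sub>R (indicator {0..1} t *\<^sub>R (t powr (s + of_nat i) * (1 - t) powr c)))
    = indicator {0..1} t *\<^sub>R (t powr s * (1 - t) powr c * poly p t)" for t :: real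
    by (cases "t \<in> {0..1}") (auto simp: powr_mult_poly_eq_sum)
  ultimately show ?thesis by simp
qed

lemma jacobi_set_integrable:
  "integrable_at_0 s p \<Longrightarrow> c > -1 \<Longrightarrow>
    set_integrable lborel {0..1} (\<lambda>t. t powr s * (1 - t) powr c * poly p t)"
  using has_bochner_integral_jacobi[of s p c] by (simp add: has_bochner_integral_iff set_integrable_def)

lemma jacobi_moment_add:
  assumes "integrable_at_0 s p" "integrable_at_0 s q" "c > -1"
  shows "jacobi_moment s c (p + q) = jacobi_moment s c p + jacobi_moment s c q"
  using set_integral_add(2)[OF assms(1)[THEN jacobi_set_integrable] assms(2)[THEN jacobi_set_integrable]] assms(3)
  unfolding jacobi_moment_def by (simp add: distrib_left)

lemma jacobi_moment_const:
  assumes "s > -1" "c > -1"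
  shows "jacobi_moment s c [:x:] = x * Beta (s + 1) (c + 1)"
  unfolding jacobi_moment_def set_lebesgue_integral_def
  by (subst has_bochner_integral_integral_eq[OF has_bochner_integral_jacobi])
    (use assms in \<open>auto simp: integrable_at_0_def coeff_pCons split: nat.splits\<close>)

lemma jacobi_moment_shift:
  "jacobi_moment s c ([:0, 1:] * [:1, -1:] * p) = jacobi_moment (s + 1) (c + 1) p"
  unfolding jacobi_moment_def
proof (intro set_lebesgue_integral_cong ballI allI impI)
  fix t :: real assume "t \<in> {0..1}"
  then have pw: "t powr (s + 1) = t powr s * t" "(1 - t) powr (c + 1) = (1 - t) powr c * (1 - t)"
    by (auto simp: powr_add)
  show "t powr s * (1 - t) powr c * poly ([:0, 1:] * [:1, - 1:] * p) t =
         t powr (s + 1) * (1 - t) powr (c + 1) * poly p t"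
    unfolding pw by (simp add: algebra_simps)
qed simp

text \<open>
  The integrand is the derivative of \<open>t\<^bsup>s+1\<^esup> (1-t)\<^bsup>c+1\<^esup> p(t)\<close>, which vanishes at both ends. Summing the
  Beta recurrence over the monomials of \<open>p\<close> replaces the discussion of boundary values, where
  \<open>s + 1\<close> may be negative.
\<close>

lemma jacobi_moment_derivative:
  assumes "integrable_at_0 s p" "c > -1"
  shows "jacobi_moment s c (smult (s + 1) ([:1, -1:] * p) + pCons 0 ([:1, -1:] * pderiv p - smult (c + 1) p)) = 0"
proof -
  let ?f = "\<lambda>i t. coeff p i *\<^sub>R ((s + of_nat i + 1) *\<^sub>R (indicator {0..1} t *\<^sub>R (t powr (s + of_nat i) * (1 - t) powr (c + 1)))
       - (c + 1) *\<^sub>R (indicator {0..1} t *\<^sub>R (t powr (s + of_nat i + 1) * (1 - t) powr c)))"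
  let ?q = "smult (s + 1) ([:1, -1:] * p) + pCons 0 ([:1, -1:] * pderiv p - smult (c + 1) p)"
  (* the part of the integrand that comes from the i-th monomial of p *)
  have "has_bochner_integral lborel (?f i) 0" for i
  proof (cases "coeff p i = 0")
    case False
    define x y where "x = s + of_nat i + 1" and "y = c + 1"
    have xy: "x > 0" "y > 0" using assms False by (auto simp: integrable_at_0_def x_def y_def)
    then have "x \<notin> \<int>\<^sub>\<le>\<^sub>0" "y \<notin> \<int>\<^sub>\<le>\<^sub>0" by (auto elim!: nonpos_Ints_cases)
    from Beta_plus1_left[OF this(1), of y] Beta_plus1_left[OF this(2), of x]
    have "(x + y) * (x * Beta x (y + 1) - y * Beta (x + 1) y) = 0"
      by (simp add: algebra_simps Beta_commute)
    then have B: "x * Beta x (y + 1) - y * Beta (x + 1) y = 0" using xy by simp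
    have "has_bochner_integral lborel (?f i) (coeff p i *\<^sub>R (x *\<^sub>R Beta x (y + 1) - y *\<^sub>R Beta (x + 1) y))"
      using has_bochner_integral_powr_Beta[of "s + of_nat i" "c + 1"] has_bochner_integral_powr_Beta[of "s + of_nat i + 1" c] xy
      unfolding x_def y_def
      by (intro has_bochner_integral_scaleR_right has_bochner_integral_diff) (auto simp: add_ac)
    then show ?thesis using B by simp
  qed (simp add: has_bochner_integral_zero)
  then have "has_bochner_integral lborel (\<lambda>t. \<Sum>i\<le>degree p. ?f i t) (\<Sum>i\<le>degree p. 0)"
    by (intro has_bochner_integral_sum)
  moreover have "(\<Sum>i\<le>degree p. ?f i t) = indicator {0..1} t *\<^sub>R (t powr s * (1 - t) powr c * poly ?q t)" for t :: real
  proof (cases "t \<in> {0..1}")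
    case True
    have pw: "t powr (s + real i) = t powr s * t ^ i" "t powr (s + real i + 1) = t powr s * t ^ i * t"
       "(1 - t) powr (c + 1) = (1 - t) powr c * (1 - t)" for i
      using True by (cases "t = 0"; auto simp: powr_add powr_realpow)+
    have d: "t * poly (pderiv p) t = (\<Sum>i\<le>degree p. of_nat i * coeff p i * t ^ i)"
    proof -
      have "t * poly (pderiv p) t = t * poly (pderiv (\<Sum>i\<le>degree p. monom (coeff p i) i)) t"
        by (simp add: poly_as_sum_of_monoms)
      also have "\<dots> = (\<Sum>i\<le>degree p. t * poly (pderiv (monom (coeff p i) i)) t)"
        using higher_pderiv_sum[of 1 "\<lambda>i. monom (coeff p i) i" "{..degree p}"]
        by (simp add: poly_sum sum_distrib_left del: poly_as_sum_of_monoms)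
      also have "\<dots> = (\<Sum>i\<le>degree p. of_nat i * coeff p i * t ^ i)"
      proof (intro sum.cong refl)
        fix i show "t * poly (pderiv (monom (coeff p i) i)) t = of_nat i * coeff p i * t ^ i"
          by (cases i) (simp_all add: pderiv_monom poly_monom mult_ac)
      qed
      finally show ?thesis .
    qed
    have "poly ?q t = ((s + 1) * (1 - t) - (c + 1) * t) * poly p t + (1 - t) * (t * poly (pderiv p) t)"
      by (simp add: algebra_simps)
    also have "\<dots> = (\<Sum>i\<le>degree p. coeff p i * ((s + of_nat i + 1) * (1 - t) - (c + 1) * t) * t ^ i)"
      unfolding d poly_altdef[of p] sum_distrib_left sum.distrib[symmetric]
      by (intro sum.cong) (auto simp: algebra_simps)
    finally have q: "poly ?q t = \<dots>" .
    show ?thesis unfolding q sum_distrib_left scaleR_sum_right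
      using True unfolding pw by (intro sum.cong) (auto simp: algebra_simps)
  qed simp
  ultimately show ?thesis
    by (simp add: has_bochner_integral_iff jacobi_moment_def set_lebesgue_integral_def)
qed

text \<open>
  Apply the previous vanishing to \<open>p = R q\<close> with \<open>R = radial_poly a b k\<close>: by the product rule, the
  terms without \<open>q'\<close> make up exactly the recursion that defines the next radial polynomial.
\<close>

lemma jacobi_moment_radial_poly_step:
  assumes "integrable_at_0 (a - of_nat (Suc k)) q" "b - of_nat (Suc k) > -1"
  shows "jacobi_moment (a - of_nat (Suc k)) (b - of_nat (Suc k)) (radial_poly a b (Suc k) * q) =
    - jacobi_moment (a - of_nat k) (b - of_nat k) (radial_poly a b k * pderiv q)"
proof -
  let ?R = "radial_poly a b k" and ?s = "a - of_nat (Suc k)" and ?c = "b - of_nat (Suc k)"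
  let ?u = "[:0, 1:] * [:1, -1:] * (?R * pderiv q)"
  have "jacobi_moment ?s ?c (radial_poly a b (Suc k) * q + ?u) = 0"
  proof -
    have "radial_poly a b (Suc k) * q + ?u = smult (?s + 1) ([:1, -1:] * (?R * q)) +
       pCons 0 ([:1, -1:] * pderiv (?R * q) - smult (?c + 1) (?R * q))"
      by (simp add: pderiv_mult algebra_simps smult_add_right smult_diff_right smult_diff_left)
    then show ?thesis
      using jacobi_moment_derivative[of ?s "?R * q" ?c] integrable_at_0_mult[OF assms(1)] assms(2) by simp
  qed
  moreover have "integrable_at_0 ?s ?u"
  proof -
    have "integrable_at_0 (?s + 1) ([:1, -1:] * (?R * pderiv q))"
      using assms(1) by (intro integrable_at_0_mult integrable_at_0_pderiv)
    then have "integrable_at_0 ?s (pCons 0 ([:1, -1:] * (?R * pderiv q)))"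
      by (rule integrable_at_0_pCons_0)
    also have "pCons 0 ([:1, -1:] * (?R * pderiv q)) = ?u" by simp
    finally show ?thesis .
  qed
  ultimately have "jacobi_moment ?s ?c (radial_poly a b (Suc k) * q) = - jacobi_moment ?s ?c ?u"
    using assms integrable_at_0_mult[OF assms(1)] by (subst (asm) jacobi_moment_add) auto
  then show ?thesis unfolding jacobi_moment_shift by simp
qed

lemma jacobi_moment_radial_poly:
  assumes "integrable_at_0 (a - of_nat m) q" "b - of_nat m > -1"
  shows "jacobi_moment (a - of_nat m) (b - of_nat m) (radial_poly a b m * q) =
    (- 1) ^ m * jacobi_moment a b ((pderiv ^^ m) q)"
  using assms
proof (induction m arbitrary: q)
  case (Suc m)
  have "integrable_at_0 (a - of_nat m) (pderiv q)"
    using integrable_at_0_pderiv[OF Suc.prems(1)] by simp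
  then show ?case
    using jacobi_moment_radial_poly_step[OF Suc.prems] Suc.IH[of "pderiv q"] Suc.prems(2)
    by (simp add: funpow_swap1 del: radial_poly.simps)
qed simp

lemma jacobi_moment_radial_poly_degree_less:
  assumes "integrable_at_0 (a - of_nat m) q" "b - of_nat m > -1" "degree q < m"
  shows "jacobi_moment (a - of_nat m) (b - of_nat m) (radial_poly a b m * q) = 0"
proof -
  have "(pderiv ^^ m) q = 0"
    using assms(3) by (intro poly_eqI) (simp add: coeff_higher_pderiv coeff_eq_0)
  then show ?thesis
    using jacobi_moment_radial_poly[OF assms(1,2)] by (simp add: jacobi_moment_def)
qed

text \<open>
  After \<open>m\<close> integrations by parts only the leading coefficient of the second factor is left, and the
  remaining integral is a Beta value. The sign \<open>(-1)\<^sup>m\<close> of the leading coefficient cancels the one from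
  the integrations.
\<close>

lemma jacobi_moment_radial_poly_square:
  assumes "integrable_at_0 (a - of_nat m) (radial_poly a (\<kappa> + of_nat m) m)" "a \<ge> 0" "\<kappa> > -1"
  shows "jacobi_moment (a - of_nat m) \<kappa> (radial_poly a (\<kappa> + of_nat m) m * radial_poly a (\<kappa> + of_nat m) m) =
    fact m * Gamma (a + 1) * Gamma (of_nat m + \<kappa> + 1) /
      ((of_nat m + a + \<kappa> + 1) * Gamma (a + \<kappa> + 1))"
proof -
  define x where "x = a + \<kappa> + 1"
  have x: "x > 0" using assms by (simp add: x_def)
  let ?R = "radial_poly a (\<kappa> + of_nat m) m"
  have npi: "y \<notin> \<int>\<^sub>\<le>\<^sub>0" if "y > 0" for y :: real
    using that by (auto elim!: nonpos_Ints_cases)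
  have poch: "pochhammer x m = Gamma (x + of_nat m) / Gamma x"
    by (rule pochhammer_Gamma[OF npi[OF x]])
  have "(pderiv ^^ m) ?R = [:(- 1) ^ m * fact m * pochhammer x m:]"
  proof (rule poly_eqI)
    fix i
    show "coeff ((pderiv ^^ m) ?R) i = coeff [:(- 1) ^ m * fact m * pochhammer x m:] i"
    proof (cases i)
      case 0
      have "a + (\<kappa> + of_nat m) - of_nat m + 1 = x" by (simp add: x_def)
      then show ?thesis using coeff_radial_poly_top[of a "\<kappa> + of_nat m" m] 0
        by (simp add: coeff_higher_pderiv pochhammer_fact)
    next
      case (Suc j)
      then show ?thesis by (simp add: coeff_higher_pderiv coeff_radial_poly_eq_0)
    qed
  qed
  then have "jacobi_moment (a - of_nat m) \<kappa> (?R * ?R) =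
      (- 1) ^ m * jacobi_moment a (\<kappa> + of_nat m) [:(- 1) ^ m * fact m * pochhammer x m:]"
    using jacobi_moment_radial_poly[of a m ?R "\<kappa> + of_nat m"] assms by simp
  also have "\<dots> = fact m * pochhammer x m * Beta (a + 1) (\<kappa> + of_nat m + 1)"
    using assms by (subst jacobi_moment_const) (auto simp flip: power_add mult.assoc power_mult_distrib)
  finally have "jacobi_moment (a - of_nat m) \<kappa> (?R * ?R) = fact m * pochhammer x m * Beta (a + 1) (\<kappa> + of_nat m + 1)" .
  moreover have "Beta (a + 1) (\<kappa> + of_nat m + 1) =
      Gamma (a + 1) * Gamma (\<kappa> + of_nat m + 1) / ((x + of_nat m) * Gamma (x + of_nat m))"
  proof -
    have "a + 1 + (\<kappa> + of_nat m + 1) = (x + of_nat m) + 1" by (simp add: x_def)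
    then show ?thesis
      unfolding Beta_def \<open>a + 1 + _ = _\<close> using Gamma_plus1[OF npi, of "x + of_nat m"] x by simp
  qed
  moreover have "Gamma (x + of_nat m) \<noteq> 0"
    using x by (intro less_imp_neq[symmetric] Gamma_real_pos) simp
  ultimately have "jacobi_moment (a - of_nat m) \<kappa> (?R * ?R) =
      fact m * Gamma (a + 1) * Gamma (\<kappa> + of_nat m + 1) / ((x + of_nat m) * Gamma x)"
    unfolding poch by (simp add: mult_ac)
  then show ?thesis by (simp add: x_def add_ac)
qed

section \<open>Rotation invariance and radial integrals on the disc\<close>

text \<open>
  The volume of a ball depends on its radius only, and a bijective isometry pulls balls back to balls
  of the same radius. By the Vitali covering theorem an open set is, up to a null set, a disjoint
  union of countably many balls. The null set is the reason for the inequality: nothing is known yet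
  about its preimage. Applying the inequality to the inverse isometry as well gives equality.
\<close>

lemma emeasure_lborel_le_isometry_vimage:
  fixes f g :: "'a::euclidean_space \<Rightarrow> 'a"
  assumes dist: "\<And>x y. dist (f x) (f y) = dist x y" and fg: "\<And>x. f (g x) = x"
    and "open S"
  shows "emeasure lborel S \<le> emeasure lborel (f -` S)"
proof -
  have cont: "continuous_on UNIV f"
    unfolding continuous_on_iff by (auto simp: dist)
  then have oS: "open (f -` S)"
    using \<open>open S\<close> by (simp add: open_vimage)
  define K where "K = {i. ball (fst i) (snd i) \<subseteq> S}"
  obtain C where C: "countable C" "C \<subseteq> K"
    "pairwise (\<lambda>i j. disjnt (ball (fst i) (snd i)) (ball (fst j) (snd j))) C"
    "negligible (S - (\<Union>i\<in>C. ball (fst i) (snd i)))"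
  proof (rule Vitali_covering_theorem_balls[of S K fst snd])
    fix x and d :: real assume "x \<in> S" "0 < d"
    then obtain e where e: "e > 0" "ball x e \<subseteq> S" using \<open>open S\<close> openE by blast
    then show "\<exists>i. i \<in> K \<and> x \<in> ball (fst i) (snd i) \<and> snd i < d"
      using \<open>0 < d\<close> by (intro exI[of _ "(x, min e (d / 2))"]) (auto simp: K_def min_def)
  qed blast
  define U where "U = (\<Union>i\<in>C. ball (fst i) (snd i))"
  have "ball (fst i) (snd i) \<subseteq> S" if "i \<in> C" for i
    using C(2) that by (auto simp: K_def)
  then have U: "U \<subseteq> S" "open U" by (auto simp: U_def)
  have vim: "f -` ball a r = ball (g a) r" for a r
  proof -
    have "dist a (f x) = dist (g a) x" for x
      using dist[of "g a" x] by (simp add: fg)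
    then show ?thesis by auto
  qed
  have disj: "disjoint_family_on (\<lambda>i. ball (fst i) (snd i)) C"
    using C(3) by (auto simp: disjoint_family_on_def pairwise_def disjnt_def)
  have "S - U \<in> null_sets lborel"
    using C(4) U \<open>open S\<close> by (auto simp: negligible_iff_null_sets null_sets_completion_iff U_def[symmetric])
  then have "emeasure lborel S = emeasure lborel U"
    using emeasure_Un_null_set[of U lborel "S - U"] U by (simp add: Un_absorb1)
  also have "\<dots> = (\<integral>\<^sup>+i. emeasure lborel (ball (fst i) (snd i)) \<partial>count_space C)"
    unfolding U_def using C(1) disj by (intro emeasure_UN_countable) auto
  also have "\<dots> = (\<integral>\<^sup>+i. emeasure lborel (f -` ball (fst i) (snd i)) \<partial>count_space C)"
  proof (intro nn_integral_cong)
    fix i :: "'a \<times> real"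
    show "emeasure lborel (ball (fst i) (snd i)) = emeasure lborel (f -` ball (fst i) (snd i))"
      unfolding vim by (cases "snd i \<ge> 0") (simp_all add: emeasure_ball ball_empty)
  qed
  also have "\<dots> = emeasure lborel (\<Union>i\<in>C. f -` ball (fst i) (snd i))"
  proof (rule emeasure_UN_countable[symmetric])
    show "disjoint_family_on (\<lambda>i. f -` ball (fst i) (snd i)) C"
      using disj unfolding disjoint_family_on_def by blast
    show "f -` ball (fst i) (snd i) \<in> sets lborel" for i by (simp add: vim)
  qed (fact C(1))
  also have "\<dots> \<le> emeasure lborel (f -` S)"
    using U oS by (intro emeasure_mono) (auto simp: U_def)
  finally show ?thesis .
qed

lemma distr_lborel_isometry:
  fixes f g :: "'a::euclidean_space \<Rightarrow> 'a"
  assumes dist: "\<And>x y. dist (f x) (f y) = dist x y" and fg: "\<And>x. f (g x) = x"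
  shows "distr lborel borel f = lborel"
proof -
  have inj: "f x = f y \<Longrightarrow> x = y" for x y using dist[of x y] by simp
  have gf: "g (f x) = x" for x using inj fg by blast
  have distg: "dist (g x) (g y) = dist x y" for x y using dist[of "g x" "g y"] by (simp add: fg)
  have cont: "continuous_on UNIV f"
    unfolding continuous_on_iff by (auto simp: dist)
  then have [measurable]: "f \<in> borel_measurable borel"
    by (rule borel_measurable_continuous_onI)
  have eq: "emeasure lborel (f -` S) = emeasure lborel S" if "open S" for S
  proof (rule antisym)
    have "open (f -` S)" using cont that by (simp add: open_vimage)
    from emeasure_lborel_le_isometry_vimage[of g f, OF distg gf this]
    show "emeasure lborel (f -` S) \<le> emeasure lborel S"
      by (simp add: vimage_def fg)
  qed (rule emeasure_lborel_le_isometry_vimage[OF dist fg that])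
  show ?thesis
  proof (rule lborel_eqI[symmetric])
    fix l u :: 'a assume lu: "\<And>b. b \<in> Basis \<Longrightarrow> l \<bullet> b \<le> u \<bullet> b"
    show "emeasure (distr lborel borel f) (box l u) = (\<Prod>b\<in>Basis. (u - l) \<bullet> b)"
      using lu by (simp add: emeasure_distr eq open_box emeasure_lborel_box del: vimage_eq)
  qed simp
qed

text \<open>
  Rotating by the angle \<open>\<pi>/d\<close> leaves the integral unchanged and multiplies the integrand by \<open>-1\<close>.
\<close>

lemma integral_eq_0_if_angular:
  fixes f :: "complex \<Rightarrow> complex" and d :: int
  assumes [measurable]: "f \<in> borel_measurable borel" and "d \<noteq> 0"
    and f: "\<And>u z. cmod u = 1 \<Longrightarrow> f (u * z) = u powi d * f z"
  shows "integral\<^sup>L lborel f = 0"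
proof -
  define u where "u = cis (pi / of_int d)"
  have u: "cmod u = 1" "u powi d = - 1"
    using \<open>d \<noteq> 0\<close> by (simp_all add: u_def cis_power_int)
  have "distr lborel borel ((*) u) = lborel"
  proof (rule distr_lborel_isometry[where g = "\<lambda>z. z / u"])
    show "dist (u * x) (u * y) = dist x y" for x y
      using u by (simp add: dist_norm norm_mult flip: right_diff_distrib)
    show "u * (x / u) = x" for x using u by auto
  qed
  then have "integral\<^sup>L lborel f = (\<integral>z. f (u * z) \<partial>lborel)"
    using integral_distr[of "(*) u" lborel borel f] by simp
  also have "\<dots> = - integral\<^sup>L lborel f"
    using u by (simp add: f)
  finally show ?thesis by simp
qed

text \<open>
  This replaces polar coordinates for radial integrands: for \<open>0 \<le> x \<le> 1\<close> the points of the disc with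
  \<open>|z|\<^sup>2 > x\<close> form an annulus of area \<open>\<pi> (1 - x)\<close>, so \<open>|z|\<^sup>2\<close> is distributed as \<open>\<pi>\<close> times the uniform measure.
\<close>

lemma distr_cmod_square_disc:
  "distr (restrict_space lborel (ball 0 1)) borel (\<lambda>z::complex. (cmod z)\<^sup>2) =
     density lborel (\<lambda>t. ennreal (pi * indicator {0..1} t))"
  (is "?M = ?N")
proof (rule measure_eqI_lessThan)
  have [measurable]: "(\<lambda>z::complex. (cmod z)\<^sup>2) \<in> borel_measurable (restrict_space lborel (ball 0 1))"
    by (intro measurable_restrict_space1) auto
  have M: "emeasure ?M {x<..} = ennreal (pi * (1 - max 0 (min 1 x)))" for x
  proof -
    (* clamping x to the unit interval covers the empty annulus and the full disc as well *)
    define y where "y = max 0 (min 1 x)"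
    have y: "0 \<le> y" "y \<le> 1" by (auto simp: y_def)
    let ?A = "ball (0::complex) 1 - cball 0 (sqrt y)"
    have "emeasure ?M {x<..} = emeasure lborel ({z::complex. cmod z < 1 \<and> x < (cmod z)\<^sup>2})"
      by (subst emeasure_distr)
        (auto simp: emeasure_restrict_space space_restrict_space Collect_conj_eq[symmetric] intro!: arg_cong[where f="emeasure lborel"])
    also have "{z::complex. cmod z < 1 \<and> x < (cmod z)\<^sup>2} = (if x < 0 then ball 0 1 else ?A)"
    proof (cases "x < 0")
      case True
      then have "x < (cmod z)\<^sup>2" for z using zero_le_power2[of "cmod z"] by linarith
      then show ?thesis using True by auto
    next
      case False
      have "x < (cmod z)\<^sup>2 \<longleftrightarrow> sqrt y < cmod z" if "cmod z < 1" for z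
      proof -
        have "(cmod z)\<^sup>2 < 1" using that by (simp add: power_less_one_iff abs_square_less_1)
        then have "x < (cmod z)\<^sup>2 \<longleftrightarrow> y < (cmod z)\<^sup>2" using False by (auto simp: y_def min_def)
        also have "\<dots> \<longleftrightarrow> sqrt y < cmod z"
          by (metis norm_ge_zero real_sqrt_less_iff real_sqrt_abs abs_of_nonneg)
        finally show ?thesis .
      qed
      then show ?thesis using False by (auto simp: not_le)
    qed
    also have "emeasure lborel \<dots> = ennreal (pi * (1 - y))"
    proof (cases "x < 0")
      case True
      then show ?thesis by (simp add: y_def emeasure_ball unit_ball_vol_2)
    next
      case False
      show ?thesis
      proof (cases "y = 1")
        case True
        then have A: "?A = {}" by auto
        show ?thesis using True False unfolding A by simp
      next
        case y1: False
        have "emeasure lborel ?A = emeasure lborel (ball (0::complex) 1) - emeasure lborel (cball (0::complex) (sqrt y))"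
          using y y1 by (intro emeasure_Diff) (auto simp: emeasure_cball cball_subset_ball_iff)
        also have "\<dots> = ennreal pi - ennreal (pi * y)"
          using y by (simp add: emeasure_ball emeasure_cball unit_ball_vol_2)
        also have "\<dots> = ennreal (pi * (1 - y))"
          using y by (simp add: ennreal_minus right_diff_distrib)
        finally show ?thesis using False by simp
      qed
    qed
    finally show ?thesis by (simp add: y_def)
  qed
  then show "emeasure ?M {x<..} < \<infinity>" for x by simp
  show "emeasure ?M {x<..} = emeasure ?N {x<..}" for x
  proof -
    have "emeasure ?N {x<..} = (\<integral>\<^sup>+t. ennreal pi * indicator ({0..1} \<inter> {x<..}) t \<partial>lborel)"
      by (subst emeasure_density) (auto intro!: nn_integral_cong simp: indicator_def)
    also have "\<dots> = ennreal pi * emeasure lborel ({0..1} \<inter> {x<..})"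
      by (subst nn_integral_cmult_indicator) auto
    also have "{0..1} \<inter> {x<..} = (if x < 0 then {0..1} else {x<..1})" by auto
    also have "emeasure lborel \<dots> = ennreal (1 - max 0 (min 1 x))"
      by (cases "x < 0"; cases "x \<le> 1") (auto)
    finally show ?thesis unfolding M by (simp add: ennreal_mult')
  qed
qed auto

section \<open>Integrals of products of Zernike functions\<close>

lemma measurable_powi [measurable]:
  "(\<lambda>z::complex. z powi k) \<in> borel_measurable borel"
  unfolding power_int_def by (cases "k \<ge> 0") simp_all

lemma sets_disc_measure: "sets (disc_measure \<kappa> \<rho>) = sets (restrict_space lborel (ball 0 1))"
  and space_disc_measure: "space (disc_measure \<kappa> \<rho>) = ball 0 1"
  by (simp_all add: disc_measure_def space_restrict_space)

lemma measurable_disc_measureI: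
  assumes "f \<in> borel_measurable borel"
  shows "f \<in> borel_measurable (disc_measure \<kappa> \<rho>)"
  using assms unfolding measurable_cong_sets[OF sets_disc_measure refl]
  by (intro measurable_restrict_space1) simp

lemma singleton_0_disc_measure:
  "{0} \<in> sets (disc_measure \<kappa> \<rho>)" "emeasure (disc_measure \<kappa> \<rho>) {0} = 0"
proof -
  show s: "{0} \<in> sets (disc_measure \<kappa> \<rho>)"
    unfolding sets_disc_measure by (subst sets_restrict_space_iff) auto
  have "{0} \<in> null_sets (restrict_space lborel (ball (0::complex) 1))"
    using s unfolding sets_disc_measure by (auto simp: null_sets_def emeasure_restrict_space)
  then have "AE z in restrict_space lborel (ball (0::complex) 1). z \<notin> {0}" by (rule AE_not_in)
  then have "{0} \<in> null_sets (disc_measure \<kappa> \<rho>)"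
    unfolding disc_measure_def using s unfolding sets_disc_measure
    by (subst null_sets_density_iff) (auto intro!: measurable_restrict_space1 elim: eventually_mono)
  then show "emeasure (disc_measure \<kappa> \<rho>) {0} = 0" by auto
qed

text \<open>
  The values of \<open>frac_zernike\<close> on the punctured disc, extended to the whole plane: the extension is
  Borel and transforms under rotations about \<open>0\<close> by a power of the rotation factor.
\<close>

definition zernike_formula :: "real \<Rightarrow> real \<Rightarrow> nat \<Rightarrow> int \<Rightarrow> complex \<Rightarrow> complex" where
  "zernike_formula \<kappa> \<rho> m n z = (- 1) ^ m * z powi (n - int m) *
     of_real (poly (radial_poly (of_int n + \<rho>) (\<kappa> + of_nat m) m) ((cmod z)\<^sup>2))"

lemma zernike_formula_measurable [measurable]: "zernike_formula \<kappa> \<rho> m n \<in> borel_measurable borel"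
proof -
  have "(\<lambda>z::complex. poly p ((cmod z)\<^sup>2)) \<in> borel_measurable borel" for p :: "real poly"
    by (intro borel_measurable_continuous_onI continuous_intros)
  then show ?thesis
    unfolding zernike_formula_def by measurable
qed

lemma frac_zernike_eq_formula:
  "z \<in> space (disc_measure \<kappa> \<rho>) \<Longrightarrow> z \<notin> {0} \<Longrightarrow> frac_zernike \<kappa> \<rho> m n z = zernike_formula \<kappa> \<rho> m n z"
  by (simp add: space_disc_measure frac_zernike_explicit zernike_formula_def)

lemma frac_zernike_measurable: "frac_zernike \<kappa> \<rho> m n \<in> borel_measurable (disc_measure \<kappa> \<rho>)"
  by (rule measurable_discrete_difference[where X = "{0}",
        OF measurable_disc_measureI[OF zernike_formula_measurable]])
    (auto simp: singleton_0_disc_measure frac_zernike_eq_formula)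

lemma has_bochner_integral_disc_radial:
  fixes h :: "real \<Rightarrow> real"
  assumes [measurable]: "h \<in> borel_measurable borel"
    and int: "set_integrable lborel {0..1} (\<lambda>t. t powr \<rho> * (1 - t) powr \<kappa> * h t)"
  shows "has_bochner_integral (disc_measure \<kappa> \<rho>) (\<lambda>z. h ((cmod z)\<^sup>2))
    (pi * (LINT t:{0..1}|lborel. t powr \<rho> * (1 - t) powr \<kappa> * h t))"
  unfolding disc_measure_def
proof (rule has_bochner_integral_density)
  let ?H = "\<lambda>t. t powr \<rho> * (1 - t) powr \<kappa> * h t"
  let ?R = "restrict_space lborel (ball (0::complex) 1)"
  have eq: "((1 - (cmod z)\<^sup>2) powr \<kappa> * cmod z powr (2 * \<rho>)) *\<^sub>R h ((cmod z)\<^sup>2) = ?H ((cmod z)\<^sup>2)" for z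
  proof -
    have "cmod z powr (2 * \<rho>) = (cmod z)\<^sup>2 powr \<rho>"
      using powr_powr[of "cmod z" 2 \<rho>] by (cases "z = 0") (simp_all add: powr_numeral)
    then show ?thesis by simp
  qed
  have [measurable]: "(\<lambda>z::complex. (cmod z)\<^sup>2) \<in> borel_measurable ?R"
    by (intro measurable_restrict_space1) auto
  have e: "(pi * indicator {0..1} t) *\<^sub>R ?H t = pi * (indicator {0..1} t *\<^sub>R ?H t)" for t by simp
  have "has_bochner_integral (distr ?R borel (\<lambda>z. (cmod z)\<^sup>2)) ?H (pi * (LINT t:{0..1}|lborel. ?H t))"
    unfolding distr_cmod_square_disc
  proof (rule has_bochner_integral_density)
    show "has_bochner_integral lborel (\<lambda>t. (pi * indicator {0..1} t) *\<^sub>R ?H t) (pi * (LINT t:{0..1}|lborel. ?H t))"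
      unfolding e set_lebesgue_integral_def
      using int by (intro has_bochner_integral_mult_right has_bochner_integral_integrable) (simp add: set_integrable_def)
  qed auto
  then show "has_bochner_integral ?R (\<lambda>z. ((1 - (cmod z)\<^sup>2) powr \<kappa> * cmod z powr (2 * \<rho>)) *\<^sub>R h ((cmod z)\<^sup>2))
     (pi * (LINT t:{0..1}|lborel. ?H t))"
    unfolding eq has_bochner_integral_iff by (simp add: integrable_distr_eq integral_distr)
qed (auto intro!: measurable_restrict_space1)

text \<open>
  With equal frequencies the phases \<open>z\<^bsup>n-m\<^esup>\<close> cancel to \<open>|z|\<^bsup>2(n-m)\<^esup>\<close>, which only shifts the exponent
  \<open>\<rho>\<close> of the weight.
\<close>

lemma has_bochner_integral_zernike_product:
  assumes k: "n - int m = n' - int m'" and "\<kappa> > -1"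
    and P: "P = radial_poly (of_int n + \<rho>) (\<kappa> + of_nat m) m"
    and P': "P' = radial_poly (of_int n' + \<rho>) (\<kappa> + of_nat m') m'"
    and adm: "integrable_at_0 (of_int n + \<rho> - of_nat m) P'"
  shows "has_bochner_integral (disc_measure \<kappa> \<rho>)
    (\<lambda>z. frac_zernike \<kappa> \<rho> m n z * cnj (frac_zernike \<kappa> \<rho> m' n' z))
    (of_real ((- 1) ^ (m + m') * pi * jacobi_moment (of_int n + \<rho> - of_nat m) \<kappa> (P * P')))"
proof -
  let ?k = "n - int m" and ?\<alpha> = "of_int n + \<rho> - of_nat m"
  let ?h = "\<lambda>t. t powr of_int ?k * poly (P * P') t"
  have [measurable]: "(\<lambda>t. poly p t) \<in> borel_measurable borel" for p :: "real poly"
    by (intro borel_measurable_continuous_onI continuous_intros)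
  have [measurable]: "?h \<in> borel_measurable borel" by (intro borel_measurable_times) auto
  have w: "t powr \<rho> * (1 - t) powr \<kappa> * ?h t = t powr ?\<alpha> * (1 - t) powr \<kappa> * poly (P * P') t" for t
  proof -
    have "t powr ?\<alpha> = t powr \<rho> * t powr of_int ?k" by (simp add: powr_add[symmetric] algebra_simps)
    then show ?thesis by (simp only: mult_ac)
  qed
  have "has_bochner_integral (disc_measure \<kappa> \<rho>) (\<lambda>z. ?h ((cmod z)\<^sup>2))
      (pi * (LINT t:{0..1}|lborel. t powr \<rho> * (1 - t) powr \<kappa> * ?h t))"
    by (rule has_bochner_integral_disc_radial)
      (use jacobi_set_integrable[OF integrable_at_0_mult[OF adm] \<open>\<kappa> > -1\<close>] in \<open>simp_all only: w, measurable\<close>)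
  then have "has_bochner_integral (disc_measure \<kappa> \<rho>) (\<lambda>z. ?h ((cmod z)\<^sup>2)) (pi * jacobi_moment ?\<alpha> \<kappa> (P * P'))"
    by (simp only: w jacobi_moment_def)
  then have "has_bochner_integral (disc_measure \<kappa> \<rho>) (\<lambda>z. (- 1) ^ (m + m') * ?h ((cmod z)\<^sup>2))
      ((- 1) ^ (m + m') * (pi * jacobi_moment ?\<alpha> \<kappa> (P * P')))"
    by (intro has_bochner_integral_mult_right)
  then have "has_bochner_integral (disc_measure \<kappa> \<rho>) (\<lambda>z. of_real ((- 1) ^ (m + m') * ?h ((cmod z)\<^sup>2)) :: complex)
      (of_real ((- 1) ^ (m + m') * (pi * jacobi_moment ?\<alpha> \<kappa> (P * P'))))"
    by (rule has_bochner_integral_of_real)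
  (* at the origin the formula is off: 0 powi 0 = 1, but 0 powr 0 = 0 *)
  also have "?this \<longleftrightarrow> ?thesis"
    unfolding mult.assoc
  proof (rule has_bochner_integral_discrete_difference[where X = "{0}"])
    fix z assume "z \<in> space (disc_measure \<kappa> \<rho>)" "z \<notin> {0}"
    then have z: "z \<noteq> 0" "cmod z < 1" by (auto simp: space_disc_measure)
    have "(z powi ?k) * cnj (z powi ?k) = (z * cnj z) powi ?k"
      by (simp add: power_int_mult_distrib)
    also have "\<dots> = of_real ((cmod z)\<^sup>2 powi ?k)"
      by (simp flip: complex_norm_square)
    also have "(cmod z)\<^sup>2 powi ?k = (cmod z)\<^sup>2 powr of_int ?k"
      using z by (subst powr_real_of_int'[symmetric]) auto
    finally have "(z powi ?k) * cnj (z powi ?k) = of_real ((cmod z)\<^sup>2 powr of_int ?k)" .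
    then have "of_real ((- 1) ^ (m + m') * ?h ((cmod z)\<^sup>2)) =
        (- 1) ^ (m + m') * (((z powi ?k) * cnj (z powi ?k)) * (of_real (poly P ((cmod z)\<^sup>2)) * of_real (poly P' ((cmod z)\<^sup>2))))"
      by simp
    also have "\<dots> = frac_zernike \<kappa> \<rho> m n z * cnj (frac_zernike \<kappa> \<rho> m' n' z)"
      using z by (simp add: frac_zernike_explicit P P' k power_add mult_ac)
    finally show "of_real ((- 1) ^ (m + m') * ?h ((cmod z)\<^sup>2)) =
      frac_zernike \<kappa> \<rho> m n z * cnj (frac_zernike \<kappa> \<rho> m' n' z)" .
  qed (auto simp: singleton_0_disc_measure)
  finally show ?thesis .
qed

text \<open>
  The product of the two functions is an eigenfunction of all rotations with the nontrivial character
  \<open>u\<^bsup>(n-m)-(n'-m')\<^esup>\<close>, and the weight is rotation invariant.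
\<close>

lemma zernike_angular_orthogonal:
  assumes k: "n - int m \<noteq> n' - int m'"
  shows "L2_inner \<kappa> \<rho> (frac_zernike \<kappa> \<rho> m n) (frac_zernike \<kappa> \<rho> m' n') = 0"
proof -
  let ?E = "zernike_formula \<kappa> \<rho>"
  define W where "W z = (1 - (cmod z)\<^sup>2) powr \<kappa> * cmod z powr (2 * \<rho>)" for z :: complex
  have cnj_measurable: "cnj \<in> borel_measurable borel"
    by (intro borel_measurable_continuous_onI continuous_intros)
  have [measurable]: "W \<in> borel_measurable borel"
    unfolding W_def by measurable
  have [measurable]: "(\<lambda>z. ?E m n z * cnj (?E m' n' z)) \<in> borel_measurable borel"
    by (intro borel_measurable_times zernike_formula_measurable
        measurable_compose[OF zernike_formula_measurable cnj_measurable])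
  have "L2_inner \<kappa> \<rho> (frac_zernike \<kappa> \<rho> m n) (frac_zernike \<kappa> \<rho> m' n') =
      (\<integral>z. ?E m n z * cnj (?E m' n' z) \<partial>disc_measure \<kappa> \<rho>)"
    unfolding L2_inner_def
    by (rule integral_discrete_difference[where X = "{0}"])
      (auto simp: singleton_0_disc_measure frac_zernike_eq_formula)
  also have "\<dots> = (\<integral>z. W z *\<^sub>R (?E m n z * cnj (?E m' n' z)) \<partial>restrict_space lborel (ball 0 1))"
    unfolding disc_measure_def W_def[symmetric]
    by (subst integral_density) (auto simp: W_def intro!: measurable_restrict_space1)
  also have "\<dots> = (\<integral>z. indicator (ball 0 1) z *\<^sub>R (W z *\<^sub>R (?E m n z * cnj (?E m' n' z))) \<partial>lborel)"
    by (subst integral_restrict_space) auto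
  also have "\<dots> = 0"
  proof (rule integral_eq_0_if_angular)
    show "(n - int m) - (n' - int m') \<noteq> 0" using k by simp
    fix u z :: complex assume u: "cmod u = 1"
    then have "u \<noteq> 0" by auto
    have E: "?E m n (u * z) = u powi (n - int m) * ?E m n z" for m n
      using u by (simp add: zernike_formula_def norm_mult power_int_mult_distrib)
    have "u powi ((n - int m) - (n' - int m')) = u powi (n - int m) * cnj (u powi (n' - int m'))"
      using u \<open>u \<noteq> 0\<close> by (subst divide_conv_cnj[symmetric]) (auto simp: norm_power_int norm_divide norm_power power_int_diff)
    then show "indicator (ball 0 1) (u * z) *\<^sub>R (W (u * z) *\<^sub>R (?E m n (u * z) * cnj (?E m' n' (u * z)))) =
      u powi ((n - int m) - (n' - int m')) * (indicator (ball 0 1) z *\<^sub>R (W z *\<^sub>R (?E m n z * cnj (?E m' n' z))))"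
      unfolding E by (simp add: W_def norm_mult u indicator_def)
  qed (intro borel_measurable_scaleR borel_measurable_indicator; simp)
  finally show ?thesis .
qed

text \<open>
  For \<open>n - m + \<rho> > -1\<close> every monomial is integrable. Otherwise \<open>\<rho>\<close> is an integer, \<open>n + \<rho>\<close> is a natural
  number \<open>N\<close>, and the monomials of degree less than \<open>m - N\<close> are missing.
\<close>

lemma integrable_at_0_zernike_radial:
  assumes "\<rho> > -1" "(m, n) \<in> zernike_indices \<rho>"
  shows "integrable_at_0 (of_int n + \<rho> - of_nat m) (radial_poly (of_int n + \<rho>) b m)"
proof (cases "of_nat m < of_int n + \<rho> + 1")
  case True
  then show ?thesis by (auto simp: integrable_at_0_def)
next
  case False
  with assms have "\<rho> \<in> \<int>" and n: "0 \<le> of_int n + \<rho>" by (auto simp: zernike_indices_def)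
  then obtain r where r: "\<rho> = of_int r" by (auto elim: Ints_cases)
  define N where "N = nat (n + r)"
  have N: "of_int n + \<rho> = of_nat N" using n by (simp add: r N_def)
  show ?thesis
    unfolding N integrable_at_0_def
  proof (intro allI impI)
    fix i assume "coeff (radial_poly (of_nat N) b m) i \<noteq> 0"
    then have "m \<le> i + N" using coeff_radial_poly_low[of i N m b] by linarith
    then show "of_nat N - of_nat m + of_nat i > (-1::real)" by linarith
  qed
qed

theorem corollary3p8:
  fixes \<kappa> \<rho> :: real
  assumes "\<rho> > -1" and "\<kappa> > -1"
  shows "orthogonal_system_L2 \<kappa> \<rho> (\<lambda>(m, n). frac_zernike \<kappa> \<rho> m n) (zernike_indices \<rho>) \<and>
    (\<forall>(m, n) \<in> zernike_indices \<rho>.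
      (L2_norm \<kappa> \<rho> (frac_zernike \<kappa> \<rho> m n))\<^sup>2 =
        pi * fact m * Gamma (of_int n + \<rho> + 1) * Gamma (of_nat m + \<kappa> + 1) /
        ((of_nat m + of_int n + \<rho> + \<kappa> + 1) * Gamma (of_int n + \<rho> + \<kappa> + 1)))"
proof -
  let ?Z = "frac_zernike \<kappa> \<rho>"
  let ?P = "\<lambda>m n. radial_poly (of_int n + \<rho>) (\<kappa> + of_nat m) m"
  have sq: "has_bochner_integral (disc_measure \<kappa> \<rho>) (\<lambda>z. (cmod (?Z m n z))\<^sup>2)
      (pi * jacobi_moment (of_int n + \<rho> - of_nat m) \<kappa> (?P m n * ?P m n))"
    if "(m, n) \<in> zernike_indices \<rho>" for m n
  proof -
    have "has_bochner_integral (disc_measure \<kappa> \<rho>) (\<lambda>z. of_real ((cmod (?Z m n z))\<^sup>2))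
        (complex_of_real (pi * jacobi_moment (of_int n + \<rho> - of_nat m) \<kappa> (?P m n * ?P m n)))"
      using has_bochner_integral_zernike_product[OF refl \<open>\<kappa> > -1\<close> refl refl
          integrable_at_0_zernike_radial[OF \<open>\<rho> > -1\<close> that]]
      by (simp only: complex_norm_square[symmetric] mult_1 power_add power_mult_distrib[symmetric])
         (simp add: power_mult_distrib[symmetric])
    from has_bochner_integral_Re[OF this] show ?thesis by simp
  qed
  have orth: "L2_inner \<kappa> \<rho> (?Z m n) (?Z m' n') = 0"
    if mn: "(m, n) \<in> zernike_indices \<rho>" "(m', n') \<in> zernike_indices \<rho>" and ne: "(m, n) \<noteq> (m', n')" for m n m' n'
  proof (cases "n - int m = n' - int m'")
    case False
    then show ?thesis by (rule zernike_angular_orthogonal)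
  next
    case k: True
    then have \<alpha>: "of_int n + \<rho> - of_nat m = of_int n' + \<rho> - of_nat m'"
      by linarith
    have adm: "integrable_at_0 (of_int n + \<rho> - of_nat m) (?P m n)" "integrable_at_0 (of_int n + \<rho> - of_nat m) (?P m' n')"
      using integrable_at_0_zernike_radial[OF \<open>\<rho> > -1\<close> mn(1)] integrable_at_0_zernike_radial[OF \<open>\<rho> > -1\<close> mn(2)]
      unfolding \<alpha> by auto
    have deg: "degree (?P m n) \<le> m" for m n by (rule degree_radial_poly_le)
    (* integrate by parts with the derivatives of the factor that has the larger first index *)
    consider "m' < m" | "m < m'" using ne k by fastforce
    then have "jacobi_moment (of_int n + \<rho> - of_nat m) \<kappa> (?P m n * ?P m' n') = 0"
    proof cases
      case 1
      show ?thesis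
        using jacobi_moment_radial_poly_degree_less[OF adm(2), of "\<kappa> + of_nat m"] \<open>\<kappa> > -1\<close>
          le_less_trans[OF deg 1] by simp
    next
      case 2
      show ?thesis
        using jacobi_moment_radial_poly_degree_less[OF adm(1)[unfolded \<alpha>], of "\<kappa> + of_nat m'"] \<open>\<kappa> > -1\<close>
          le_less_trans[OF deg 2] unfolding \<alpha> by (simp add: mult.commute)
    qed
    then show ?thesis
      using has_bochner_integral_integral_eq[OF has_bochner_integral_zernike_product[OF k \<open>\<kappa> > -1\<close> refl refl adm(2)]]
      by (simp add: L2_inner_def)
  qed
  have norm: "(L2_norm \<kappa> \<rho> (?Z m n))\<^sup>2 =
        pi * fact m * Gamma (of_int n + \<rho> + 1) * Gamma (of_nat m + \<kappa> + 1) /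
        ((of_nat m + of_int n + \<rho> + \<kappa> + 1) * Gamma (of_int n + \<rho> + \<kappa> + 1))"
    if mn: "(m, n) \<in> zernike_indices \<rho>" for m n
  proof -
    have "(L2_norm \<kappa> \<rho> (?Z m n))\<^sup>2 = (\<integral>z. (cmod (?Z m n z))\<^sup>2 \<partial>disc_measure \<kappa> \<rho>)"
      unfolding L2_norm_def by (simp add: integral_nonneg)
    also have "\<dots> = pi * jacobi_moment (of_int n + \<rho> - of_nat m) \<kappa> (?P m n * ?P m n)"
      by (rule has_bochner_integral_integral_eq[OF sq[OF mn]])
    also have "jacobi_moment (of_int n + \<rho> - of_nat m) \<kappa> (?P m n * ?P m n) =
        fact m * Gamma (of_int n + \<rho> + 1) * Gamma (of_nat m + \<kappa> + 1) /
        ((of_nat m + (of_int n + \<rho>) + \<kappa> + 1) * Gamma (of_int n + \<rho> + \<kappa> + 1))"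
      using mn \<open>\<kappa> > -1\<close> integrable_at_0_zernike_radial[OF \<open>\<rho> > -1\<close> mn]
      by (intro jacobi_moment_radial_poly_square) (auto simp: zernike_indices_def)
    finally show ?thesis by (simp add: add_ac mult_ac)
  qed
  have "in_L2 \<kappa> \<rho> (?Z m n)" if "(m, n) \<in> zernike_indices \<rho>" for m n
    using sq[OF that] frac_zernike_measurable by (simp add: in_L2_def has_bochner_integral_iff)
  with orth norm show ?thesis
    unfolding orthogonal_system_L2_def by auto
qed

end
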